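(* Let $G$ be a finite $1$-outregular digraph. Then $G$ is a semigroup digraph if and only if $G$ has a connected component $\mathcal C$ such that for all connected components $\mathcal D$ of $G$, $z(\mathcal D)$ divides $z(\mathcal C)$ and $\ell(\mathcal D)\leq \ell(\mathcal C)+1$.
   Context: All semigroups and digraphs are finite and nonempty. Directed graphs may have loops and anti-parallel arcs but no parallel arcs. For a semigroup $S$ and $C\subseteq S$, $\mathrm{Cay}(S,C)$ is the directed graph with vertex set $S$ and arc set $\{(s,sc)\mid s\in S,\ c\in C\}$. A semigroup digraph is a directed graph isomorphic to $\mathrm{Cay}(S,C)$ for some semigroup $S$ and some $C\subseteq S$. A digraph is $1$-outregular if every vertex has outdegree exactly $1$ (a loop counts as an out-arc). Connected components are those of the underlying undirected graph. In a $1$-outregular digraph each connected component $\mathcal C$ contains exactly one directed cycle $Z$ (possibly a loop). $z(\mathcal C)$ denotes the length of $Z$ (a loop has length $1$). For a vertex $v$ of $\mathcal C$, $\ell(v)$ is the length of the unique shortest directed path from $v$ to $Z$ (so $\ell(v)=0$ if $v\in Z$), and $\ell(\mathcal C)=\max_{v\in\mathcal C}\ell(v)$. *)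

theory Defs
  imports
    "Graph_Theory.Pair_Digraph"
    "Graph_Theory.Digraph_Component"
    "Graph_Theory.Digraph_Isomorphism"
begin

locale finite_semigroup =
  fixes S :: "'a set" and mul :: "'a \<Rightarrow> 'a \<Rightarrow> 'a"
  assumes finite_carrier: "finite S"
    and nonempty_carrier: "S \<noteq> {}"
    and closed: "\<And>x y. x \<in> S \<Longrightarrow> y \<in> S \<Longrightarrow> mul x y \<in> S"
    and assoc: "\<And>x y z. x \<in> S \<Longrightarrow> y \<in> S \<Longrightarrow> z \<in> S \<Longrightarrow> mul (mul x y) z = mul x (mul y z)"

definition Cay :: "'a set \<Rightarrow> ('a \<Rightarrow> 'a \<Rightarrow> 'a) \<Rightarrow> 'a set \<Rightarrow> 'a pair_pre_digraph" where
  "Cay S mul C = \<lparr> pverts = S, parcs = {(s, mul s c) | s c. s \<in> S \<and> c \<in> C} \<rparr>"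

text \<open>
  HOL cannot quantify over types inside a definition. As semigroups are finite, taking
  carriers that are sets of natural numbers loses no generality;
  \<open>semigroup_digraphI\<close> below confirms that a carrier of any type may be used.
\<close>
definition semigroup_digraph :: "'a pair_pre_digraph \<Rightarrow> bool" where
  "semigroup_digraph G \<longleftrightarrow>
    (\<exists>(S :: nat set) mul C. finite_semigroup S mul \<and> C \<subseteq> S \<and>
      digraph_iso (with_proj G) (with_proj (Cay S mul C)))"

lemma (in finite_semigroup) wf_Cay:
  assumes "C \<subseteq> S"
  shows "pair_wf_digraph (Cay S mul C)"
  using assms closed by unfold_locales (auto simp: Cay_def)

lemma semigroup_digraphI:
  fixes S :: "'b set"
  assumes sg: "finite_semigroup S mul" and C: "C \<subseteq> S"
    and iso: "digraph_iso (with_proj G) (with_proj (Cay S mul C))"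
  shows "semigroup_digraph G"
proof -
  interpret finite_semigroup S mul by fact
  obtain f :: "'b \<Rightarrow> nat" where f: "inj_on f S"
    using finite_carrier finite_imp_inj_to_nat_seg by metis
  define g where "g = the_inv_into S f"
  define m where "m = (\<lambda>x y. f (mul (g x) (g y)))"
  have gf [simp]: "g (f x) = x" if "x \<in> S" for x
    using that f by (simp add: g_def the_inv_into_f_f)
  have sg': "finite_semigroup (f ` S) m"
    by unfold_locales (auto simp: m_def closed assoc finite_carrier nonempty_carrier)
  have sub: "f ` C \<subseteq> f ` S" using C by auto
  interpret P: pair_wf_digraph "Cay S mul C" by (rule wf_Cay[OF C])
  define h where "h = \<lparr> iso_verts = f, iso_arcs = map_prod f f,
    iso_head = snd, iso_tail = fst \<rparr>"
  have arcs: "parcs (Cay (f ` S) m (f ` C)) = map_prod f f ` parcs (Cay S mul C)"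
  proof (intro equalityI subsetI)
    fix e assume "e \<in> parcs (Cay (f ` S) m (f ` C))"
    then obtain s c where "s \<in> S" "c \<in> C" "e = (f s, m (f s) (f c))"
      by (auto simp: Cay_def)
    then have "e = map_prod f f (s, mul s c)" "(s, mul s c) \<in> parcs (Cay S mul C)"
      using C by (auto simp: Cay_def m_def subset_iff)
    then show "e \<in> map_prod f f ` parcs (Cay S mul C)" by blast
  next
    fix e assume "e \<in> map_prod f f ` parcs (Cay S mul C)"
    then obtain s c where sc: "s \<in> S" "c \<in> C" "e = (f s, f (mul s c))"
      by (auto simp: Cay_def)
    then have "e = (f s, m (f s) (f c))"
      using C by (auto simp: m_def subset_iff)
    moreover have "f s \<in> f ` S" "f c \<in> f ` C" using sc by auto
    ultimately show "e \<in> parcs (Cay (f ` S) m (f ` C))" unfolding Cay_def by (simp, blast)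
  qed
  have "parcs (Cay S mul C) \<subseteq> S \<times> S"
    using C closed by (auto simp: Cay_def)
  moreover have "inj_on (map_prod f f) (S \<times> S)"
    using f by (simp add: map_prod_inj_on)
  ultimately have "inj_on (map_prod f f) (parcs (Cay S mul C))"
    by (rule inj_on_subset[rotated])
  then have "pre_digraph.digraph_isomorphism (with_proj (Cay S mul C)) h"
    unfolding pre_digraph.digraph_isomorphism_def using f P.wf_digraph
    by (auto simp: h_def Cay_def)
  moreover have "with_proj (Cay (f ` S) m (f ` C)) = app_iso h (with_proj (Cay S mul C))"
    using arcs by (simp add: app_iso_def h_def with_proj_def) (simp add: Cay_def)
  ultimately have "digraph_iso (with_proj (Cay S mul C)) (with_proj (Cay (f ` S) m (f ` C)))"
    unfolding digraph_iso_def by blast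
  then have "digraph_iso (with_proj G) (with_proj (Cay (f ` S) m (f ` C)))"
    using iso digraph_iso_trans by blast
  then show ?thesis
    unfolding semigroup_digraph_def using sg' sub by blast
qed

definition one_outregular :: "('a,'b) pre_digraph \<Rightarrow> bool" where
  "one_outregular G \<longleftrightarrow> (\<forall>v \<in> verts G. out_degree G v = 1)"

text \<open>
  \<^const>\<open>connected\<close> here is the notion of the graph library: connectedness of the
  symmetrization, i.e.\ of the underlying undirected graph.
\<close>
definition components :: "('a,'b) pre_digraph \<Rightarrow> ('a,'b) pre_digraph set" where
  "components G = {H. pre_digraph.max_subgraph G connected H}"

text \<open>
  Library cycles are nonempty arc lists, so a loop counts as a cycle of length 1. The
  definitions below are meaningful for a component of a finite 1-outregular digraph, where
  the directed cycle is unique up to the choice of its starting point.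
\<close>
definition cycle_length :: "('a,'b) pre_digraph \<Rightarrow> nat" where
  "cycle_length H = (THE n. \<exists>p. pre_digraph.cycle H p \<and> length p = n)"

definition cycle_verts :: "('a,'b) pre_digraph \<Rightarrow> 'a set" where
  "cycle_verts H = {tail H e | e p. pre_digraph.cycle H p \<and> e \<in> set p}"

definition dist_to_cycle :: "('a,'b) pre_digraph \<Rightarrow> 'a \<Rightarrow> nat" where
  "dist_to_cycle H v =
    (LEAST n. \<exists>p w. w \<in> cycle_verts H \<and> pre_digraph.apath H v p w \<and> length p = n)"

definition height :: "('a,'b) pre_digraph \<Rightarrow> nat" where
  "height H = Max (dist_to_cycle H ` verts H)"

end

theory Submission
  imports Defs
begin

text \<open>
  A 1-outregular digraph is the graph of a self-map \<open>f\<close> of its vertex set, and it is a Cayley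
  graph iff \<open>f\<close> is the right translation by some element \<open>c\<close> of a semigroup on the vertices.
  Then \<open>f\<^sup>i\<^sup>+\<^sup>1 x = x f\<^sup>i(c)\<close>, so every coincidence \<open>f\<^sup>i(c) = f\<^sup>j(c)\<close> forces
  \<open>f\<^sup>i\<^sup>+\<^sup>1 = f\<^sup>j\<^sup>+\<^sup>1\<close>; in terms of preperiods and periods this is the
  condition on components, with \<open>c\<close> a vertex of maximal distance to the cycle. Conversely, under
  this condition the exponent 1 at \<open>c\<close> extends to exponents \<open>a(y)\<close> for all \<open>y\<close> in the component
  of \<open>c\<close> such that \<open>a(f y)\<close> and \<open>a(y) + 1\<close> give the same power of \<open>f\<close>. The product \<open>x y\<close> is then
  \<open>f\<^bsup>a(y)\<^esup> x\<close> for \<open>y\<close> in that component, and \<open>y\<close> otherwise.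
\<close>

section \<open>Eventually periodic points of a self-map\<close>

definition periodic :: "('a \<Rightarrow> 'a) \<Rightarrow> 'a \<Rightarrow> bool" where
  "periodic f x \<longleftrightarrow> (\<exists>n>0. (f ^^ n) x = x)"

definition period :: "('a \<Rightarrow> 'a) \<Rightarrow> 'a \<Rightarrow> nat" where
  "period f x = (LEAST n. 0 < n \<and> (f ^^ n) x = x)"

definition eventually_periodic :: "('a \<Rightarrow> 'a) \<Rightarrow> 'a \<Rightarrow> bool" where
  "eventually_periodic f x \<longleftrightarrow> (\<exists>n. periodic f ((f ^^ n) x))"

definition preperiod :: "('a \<Rightarrow> 'a) \<Rightarrow> 'a \<Rightarrow> nat" where
  "preperiod f x = (LEAST n. periodic f ((f ^^ n) x))"

text \<open>The length of the cycle that the orbit of \<open>x\<close> enters. In graph terms,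
  \<open>preperiod\<close> becomes the distance of a vertex to the cycle and
  \<open>eventual_period\<close> the cycle length of its component.\<close>

definition eventual_period :: "('a \<Rightarrow> 'a) \<Rightarrow> 'a \<Rightarrow> nat" where
  "eventual_period f x = period f ((f ^^ preperiod f x) x)"

lemma funpow_shift:
  fixes f :: "'a \<Rightarrow> 'a"
  shows "(f ^^ m) x = (f ^^ n) y \<Longrightarrow> (f ^^ (k + m)) x = (f ^^ (k + n)) y"
  by (simp add: funpow_add)

lemma funpow_swap: "(f ^^ m) ((f ^^ n) x) = (f ^^ n) ((f ^^ m) x)"
  by (metis add.commute comp_apply funpow_add)

lemma periodic_funpow: "periodic f x \<Longrightarrow> periodic f ((f ^^ n) x)"
  unfolding periodic_def by (metis funpow_swap)

lemma period_props:
  assumes "periodic f x"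
  shows period_pos: "0 < period f x" and funpow_period: "(f ^^ period f x) x = x"
  using LeastI_ex[of "\<lambda>n. 0 < n \<and> (f ^^ n) x = x"] assms
  by (auto simp: periodic_def period_def)

lemma funpow_eq_self_iff:
  assumes "periodic f x"
  shows "(f ^^ n) x = x \<longleftrightarrow> period f x dvd n"
proof
  assume *: "(f ^^ n) x = x"
  have "(f ^^ (n mod period f x)) x = x"
    using funpow_mod_eq[OF funpow_period[OF assms]] * by simp
  moreover have "n mod period f x < period f x"
    using period_pos[OF assms] by simp
  ultimately have "n mod period f x = 0"
    using not_less_Least[of "n mod period f x" "\<lambda>n. 0 < n \<and> (f ^^ n) x = x"]
    by (auto simp: period_def)
  then show "period f x dvd n" by auto
next
  assume "period f x dvd n"
  then show "(f ^^ n) x = x"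
    using funpow_mod_eq[OF funpow_period[OF assms], of n] by simp
qed

lemma funpow_mult_period:
  "periodic f x \<Longrightarrow> (f ^^ (k * period f x)) x = x"
  by (simp add: funpow_eq_self_iff)

text \<open>Iterating both sides further, up to a common multiple \<open>n >= k\<close> of the two
  periods, returns each point to itself. So \<open>f\<close> is injective on its periodic
  points.\<close>

lemma funpow_cancel:
  assumes "periodic f x" "periodic f y" "(f ^^ k) x = (f ^^ k) y"
  shows "x = y"
proof -
  define n where "n = k * (period f x * period f y)"
  have "k \<le> n" using assms period_pos[of f x] period_pos[of f y]
    by (simp add: n_def Suc_le_eq)
  then have "(f ^^ n) x = (f ^^ n) y"
    using funpow_shift[OF assms(3), of "n - k"] by simp
  moreover have "(f ^^ n) x = x" "(f ^^ n) y = y"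
    using assms by (auto simp: n_def funpow_eq_self_iff)
  ultimately show ?thesis by simp
qed

lemma period_funpow:
  assumes "periodic f x"
  shows "period f ((f ^^ n) x) = period f x"
proof -
  have "(f ^^ m) ((f ^^ n) x) = (f ^^ n) x \<longleftrightarrow> (f ^^ m) x = x" for m
    using funpow_cancel[of f "(f ^^ m) x" x n] periodic_funpow[OF assms] assms
    by (metis funpow_swap)
  then show ?thesis by (simp add: period_def)
qed

lemma periodic_funpow_iff:
  assumes "eventually_periodic f x"
  shows "periodic f ((f ^^ n) x) \<longleftrightarrow> preperiod f x \<le> n"
proof
  show "periodic f ((f ^^ n) x) \<Longrightarrow> preperiod f x \<le> n"
    unfolding preperiod_def by (rule Least_le)
next
  have *: "periodic f ((f ^^ preperiod f x) x)"
    using assms LeastI_ex unfolding eventually_periodic_def preperiod_def by fast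
  assume "preperiod f x \<le> n"
  then have "(f ^^ n) x = (f ^^ (n - preperiod f x)) ((f ^^ preperiod f x) x)"
    by (metis comp_apply funpow_add le_add_diff_inverse2)
  then show "periodic f ((f ^^ n) x)"
    using periodic_funpow[OF *] by simp
qed

lemma period_funpow_eventual:
  assumes "eventually_periodic f x" "preperiod f x \<le> n"
  shows "period f ((f ^^ n) x) = eventual_period f x"
proof -
  have "(f ^^ n) x = (f ^^ (n - preperiod f x)) ((f ^^ preperiod f x) x)"
    by (metis assms(2) comp_apply funpow_add le_add_diff_inverse2)
  then show ?thesis
    using periodic_funpow_iff[OF assms(1), of "preperiod f x"]
    by (simp add: period_funpow eventual_period_def)
qed

lemma eventual_period_periodic:
  assumes "periodic f x"
  shows "preperiod f x = 0" and "eventual_period f x = period f x"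
proof -
  show *: "preperiod f x = 0"
    unfolding preperiod_def using assms by (intro Least_eq_0) simp
  show "eventual_period f x = period f x"
    by (simp add: eventual_period_def *)
qed

text \<open>A coincidence makes \<open>(f ^^ i) x\<close> return to itself after
  \<open>j - i > 0\<close> steps, so this point is periodic and its period divides
  \<open>j - i\<close>. For \<open>i = j\<close> the iterates agree even below the preperiod, hence
  the strict inequality.\<close>

lemma funpow_eq_funpow_iff:
  assumes "eventually_periodic f x" "i < j"
  shows "(f ^^ i) x = (f ^^ j) x \<longleftrightarrow> preperiod f x \<le> i \<and> eventual_period f x dvd j - i"
proof -
  have *: "(f ^^ j) x = (f ^^ (j - i)) ((f ^^ i) x)"
    using assms(2) by (metis comp_apply funpow_add le_add_diff_inverse2 less_imp_le)
  have "periodic f ((f ^^ i) x)" if "(f ^^ i) x = (f ^^ j) x"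
    unfolding periodic_def using that * assms(2) by (metis zero_less_diff)
  then show ?thesis
    using * funpow_eq_self_iff[of f "(f ^^ i) x" "j - i"] periodic_funpow_iff[OF assms(1), of i]
      period_funpow_eventual[OF assms(1), of i]
    by auto
qed

lemma eventual_period_pos: "eventually_periodic f x \<Longrightarrow> 0 < eventual_period f x"
  unfolding eventual_period_def by (simp add: period_pos periodic_funpow_iff)

text \<open>Orbits that have met stay together, and after \<open>?k\<close> further steps both have
  passed their preperiods.\<close>

lemma eventual_period_eqI:
  assumes "eventually_periodic f x" "eventually_periodic f y" "(f ^^ i) x = (f ^^ j) y"
  shows "eventual_period f x = eventual_period f y"
proof -
  let ?k = "preperiod f x + preperiod f y"
  have "(f ^^ (?k + i)) x = (f ^^ (?k + j)) y"
    by (rule funpow_shift[OF assms(3)])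
  then show ?thesis
    using period_funpow_eventual[OF assms(1), of "?k + i"]
      period_funpow_eventual[OF assms(2), of "?k + j"] by simp
qed

text \<open>All coincidences in the orbit of \<open>c\<close> follow from the first one, between the
  preperiod and one period later. Demanding it for \<open>x\<close> with both exponents raised by
  one gives the two conditions; this raise is the source of the \<open>+ 1\<close>.\<close>

lemma orbit_collisions_iff:
  assumes c: "eventually_periodic f c" and x: "eventually_periodic f x"
  shows "(\<forall>i j. (f ^^ i) c = (f ^^ j) c \<longrightarrow> (f ^^ Suc i) x = (f ^^ Suc j) x) \<longleftrightarrow>
    preperiod f x \<le> preperiod f c + 1 \<and> eventual_period f x dvd eventual_period f c"
    (is "?L \<longleftrightarrow> ?R")
proof
  assume L: ?L
  let ?i = "preperiod f c" and ?z = "eventual_period f c"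
  have z: "0 < ?z" using c by (rule eventual_period_pos)
  then have "(f ^^ ?i) c = (f ^^ (?i + ?z)) c"
    using funpow_eq_funpow_iff[OF c, of ?i "?i + ?z"] by simp
  then have "(f ^^ Suc ?i) x = (f ^^ Suc (?i + ?z)) x" using L by blast
  then show ?R using funpow_eq_funpow_iff[OF x, of "Suc ?i" "Suc (?i + ?z)"] z by simp
next
  assume R: ?R
  have *: "(f ^^ Suc i) x = (f ^^ Suc j) x" if "i < j" "(f ^^ i) c = (f ^^ j) c" for i j
    using that funpow_eq_funpow_iff[OF c, of i j] funpow_eq_funpow_iff[OF x, of "Suc i" "Suc j"] R
    by auto
  show ?L
  proof (intro allI impI)
    fix i j assume "(f ^^ i) c = (f ^^ j) c"
    then show "(f ^^ Suc i) x = (f ^^ Suc j) x"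
      using *[of i j] *[of j i] by (cases i j rule: linorder_cases) auto
  qed
qed

section \<open>Functional digraphs\<close>

locale functional_digraph =
  fixes G :: "'a pair_pre_digraph" and f :: "'a \<Rightarrow> 'a"
  assumes finite_pverts: "finite (pverts G)"
    and parcs_eq: "parcs G = (\<lambda>v. (v, f v)) ` pverts G"
    and f_closed: "v \<in> pverts G \<Longrightarrow> f v \<in> pverts G"
begin

sublocale pair_wf_digraph G
  by unfold_locales (auto simp: parcs_eq f_closed)

lemma funpow_closed: "v \<in> pverts G \<Longrightarrow> (f ^^ n) v \<in> pverts G"
  by (induction n) (auto simp: f_closed)

text \<open>Pigeonhole: the exponents up to \<open>card (pverts G)\<close> outnumber the vertices,
  and of two equal iterates the earlier one is periodic.\<close>

lemma eventually_periodic_vertex: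
  assumes "v \<in> pverts G"
  shows "eventually_periodic f v"
proof -
  have "\<not> inj_on (\<lambda>n. (f ^^ n) v) {..card (pverts G)}"
  proof (rule pigeonhole)
    have "(\<lambda>n. (f ^^ n) v) ` {..card (pverts G)} \<subseteq> pverts G"
      using funpow_closed[OF assms] by auto
    then have "card ((\<lambda>n. (f ^^ n) v) ` {..card (pverts G)}) \<le> card (pverts G)"
      by (rule card_mono[OF finite_pverts])
    then show "card ((\<lambda>n. (f ^^ n) v) ` {..card (pverts G)}) < card {..card (pverts G)}"
      by simp
  qed
  then obtain i j where "i < j" "(f ^^ i) v = (f ^^ j) v"
    unfolding inj_on_def by (metis linorder_neqE_nat)
  then have "(f ^^ (j - i)) ((f ^^ i) v) = (f ^^ i) v"
    by (metis comp_apply funpow_add le_add_diff_inverse2 less_imp_le)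
  moreover have "0 < j - i" using \<open>i < j\<close> by simp
  ultimately show ?thesis unfolding eventually_periodic_def periodic_def by blast
qed

section \<open>Walks, cycles and distances in terms of orbits\<close>

primrec orbit_walk :: "'a \<Rightarrow> nat \<Rightarrow> ('a \<times> 'a) list" where
  "orbit_walk v 0 = []"
| "orbit_walk v (Suc n) = (v, f v) # orbit_walk (f v) n"

lemma length_orbit_walk [simp]: "length (orbit_walk v n) = n"
  by (induction n arbitrary: v) auto

text \<open>With a single out-arc at every vertex, a walk is determined by its start and its
  length.\<close>

lemma awalk_iff:
  "awalk v p w \<longleftrightarrow> v \<in> pverts G \<and> (\<exists>n. p = orbit_walk v n \<and> w = (f ^^ n) v)"
proof (induction p arbitrary: v)
  case Nil
  have "[] = orbit_walk v n \<longleftrightarrow> n = 0" for n by (cases n) auto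
  then show ?case by (auto simp: awalk_Nil_iff)
next
  case (Cons e p)
  have "awalk v (e # p) w \<longleftrightarrow> v \<in> pverts G \<and> e = (v, f v) \<and> awalk (f v) p w"
    by (auto simp: awalk_Cons_iff parcs_eq)
  also have "\<dots> \<longleftrightarrow> v \<in> pverts G \<and> (\<exists>n. e # p = orbit_walk v (Suc n) \<and> w = (f ^^ Suc n) v)"
    unfolding Cons.IH by (auto simp: f_closed funpow_swap1)
  also have "\<dots> \<longleftrightarrow> v \<in> pverts G \<and> (\<exists>n. e # p = orbit_walk v n \<and> w = (f ^^ n) v)"
    by (metis list.distinct(1) not0_implies_Suc orbit_walk.simps(1))
  finally show ?case .
qed

lemma awalk_orbit_walk: "v \<in> pverts G \<Longrightarrow> awalk v (orbit_walk v n) ((f ^^ n) v)"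
  by (auto simp: awalk_iff)

lemma awalk_verts_orbit_walk:
  "awalk_verts v (orbit_walk v n) = map (\<lambda>i. (f ^^ i) v) [0..<Suc n]"
proof (induction n arbitrary: v)
  case (Suc n)
  have "map (\<lambda>i. (f ^^ i) v) [0..<Suc (Suc n)] = v # map (\<lambda>i. (f ^^ Suc i) v) [0..<Suc n]"
    by (subst map_upt_Suc) simp
  then show ?case
    using Suc[of "f v"] by (simp add: funpow_swap1 del: upt_Suc)
qed simp

lemma tails_orbit_walk: "fst ` set (orbit_walk v n) = (\<lambda>i. (f ^^ i) v) ` {..<n}"
  by (induction n arbitrary: v) (auto simp: lessThan_Suc_eq_insert_0 image_image funpow_swap1)

text \<open>The length of a nonempty closed walk from \<open>v\<close> is a positive multiple of the
  period, and distinctness of the vertices allows only one turn.\<close>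

lemma cycle_iff:
  "cycle p \<longleftrightarrow> (\<exists>v\<in>pverts G. periodic f v \<and> p = orbit_walk v (period f v))" (is "?L \<longleftrightarrow> ?R")
proof
  assume ?L
  then obtain v where v: "awalk v p v" "distinct (tl (awalk_verts v p))" "p \<noteq> []"
    unfolding cycle_def by auto
  then obtain n where vV: "v \<in> pverts G" and p: "p = orbit_walk v n" and fn: "(f ^^ n) v = v"
    by (auto simp: awalk_iff)
  have n: "0 < n" using p v(3) by (cases n) auto
  have per: "periodic f v" using fn n by (auto simp: periodic_def)
  have "tl (awalk_verts v p) = map (\<lambda>i. (f ^^ i) v) [1..<Suc n]"
    unfolding p awalk_verts_orbit_walk by (simp add: map_tl[symmetric] del: upt_Suc)
  then have inj: "inj_on (\<lambda>i. (f ^^ i) v) {1..<Suc n}"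
    using v(2) by (simp add: distinct_map del: upt_Suc)
  have "period f v \<le> n"
    using funpow_eq_self_iff[OF per, of n] fn n by (simp add: dvd_imp_le)
  \<comment> \<open>Both exponents lie in the range of injectivity and lead back to
    \<open>v\<close>; a longer closed walk would pass through \<open>v\<close> too early.\<close>
  then have "period f v = n"
    using inj_onD[OF inj, of "period f v" n] funpow_period[OF per] fn period_pos[OF per] n
    by auto
  then show ?R using vV p per by auto
next
  assume ?R
  then obtain v where v: "v \<in> pverts G" "periodic f v" and p: "p = orbit_walk v (period f v)"
    by auto
  let ?n = "period f v"
  \<comment> \<open>The pair \<open>i = 0\<close>, \<open>j = ?n\<close> has to be left out, since
    both iterates are \<open>v\<close>; correspondingly, \<open>tl\<close> drops the first
    occurrence of the start.\<close>
  have *: "\<not> (f ^^ i) v = (f ^^ j) v" if "0 < i" "i < j" "j \<le> ?n" for i j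
    using that funpow_eq_funpow_iff[OF eventually_periodic_vertex[OF v(1)], of i j]
    by (auto simp: eventual_period_periodic[OF v(2)] dest: dvd_imp_le)
  have "inj_on (\<lambda>i. (f ^^ i) v) {1..<Suc ?n}"
  proof (rule inj_onI)
    fix i j assume "i \<in> {1..<Suc ?n}" "j \<in> {1..<Suc ?n}" "(f ^^ i) v = (f ^^ j) v"
    then show "i = j" using *[of i j] *[of j i] by (cases i j rule: linorder_cases) auto
  qed
  moreover have "tl (awalk_verts v p) = map (\<lambda>i. (f ^^ i) v) [1..<Suc ?n]"
    unfolding p awalk_verts_orbit_walk by (simp add: map_tl[symmetric] del: upt_Suc)
  ultimately have "distinct (tl (awalk_verts v p))"
    by (simp add: distinct_map del: upt_Suc)
  moreover have "awalk v p v"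
    using awalk_orbit_walk[OF v(1), of ?n] funpow_period[OF v(2)] p by simp
  moreover have "p \<noteq> []" using p period_pos[OF v(2)] by (metis length_0_conv length_orbit_walk neq0_conv)
  ultimately show ?L unfolding cycle_def by blast
qed

lemma cycle_verts_eq: "cycle_verts (with_proj G) = {v \<in> pverts G. periodic f v}"
proof (intro set_eqI iffI)
  fix v assume "v \<in> cycle_verts (with_proj G)"
  then obtain e p where "v = fst e" "cycle p" "e \<in> set p"
    unfolding cycle_verts_def by auto
  then obtain u where u: "u \<in> pverts G" "periodic f u" "v \<in> fst ` set (orbit_walk u (period f u))"
    unfolding cycle_iff by auto
  then show "v \<in> {v \<in> pverts G. periodic f v}"
    unfolding tails_orbit_walk using funpow_closed periodic_funpow by auto
next
  fix v assume "v \<in> {v \<in> pverts G. periodic f v}"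
  then have v: "v \<in> pverts G" "periodic f v" by auto
  then have "v \<in> fst ` set (orbit_walk v (period f v))"
    unfolding tails_orbit_walk using period_pos[OF v(2)] by (auto intro!: image_eqI[of _ _ 0])
  then obtain e where "v = fst e" "e \<in> set (orbit_walk v (period f v))" by auto
  moreover have "cycle (orbit_walk v (period f v))" using v by (auto simp: cycle_iff)
  ultimately show "v \<in> cycle_verts (with_proj G)"
    unfolding cycle_verts_def by (simp only: with_proj_simps mem_Collect_eq) blast
qed

text \<open>No iterate before the preperiod recurs, so the orbit up to its first periodic vertex is
  a path. Every walk is an orbit segment, and one that ends on the cycle is at least this
  long.\<close>

lemma dist_to_cycle_eq:
  assumes v: "v \<in> pverts G"
  shows "dist_to_cycle (with_proj G) v = preperiod f v"
  unfolding dist_to_cycle_def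
proof (rule Least_equality)
  note ev = eventually_periodic_vertex[OF v]
  let ?n = "preperiod f v"
  have *: "\<not> (f ^^ i) v = (f ^^ j) v" if "i < j" "j \<le> ?n" for i j
    using that funpow_eq_funpow_iff[OF ev, of i j] by auto
  have "inj_on (\<lambda>i. (f ^^ i) v) {0..<Suc ?n}"
  proof (rule inj_onI)
    fix i j assume "i \<in> {0..<Suc ?n}" "j \<in> {0..<Suc ?n}" "(f ^^ i) v = (f ^^ j) v"
    then show "i = j" using *[of i j] *[of j i] by (cases i j rule: linorder_cases) auto
  qed
  then have "apath v (orbit_walk v ?n) ((f ^^ ?n) v)"
    unfolding apath_def awalk_verts_orbit_walk using awalk_orbit_walk[OF v]
    by (simp add: distinct_map del: upt_Suc)
  moreover have "(f ^^ ?n) v \<in> cycle_verts (with_proj G)"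
    using periodic_funpow_iff[OF ev, of ?n] funpow_closed[OF v] by (simp add: cycle_verts_eq)
  ultimately show "\<exists>p w. w \<in> cycle_verts (with_proj G) \<and> apath v p w \<and> length p = ?n"
    using length_orbit_walk by blast
next
  fix n assume "\<exists>p w. w \<in> cycle_verts (with_proj G) \<and> apath v p w \<and> length p = n"
  then have "periodic f ((f ^^ n) v)"
    by (auto simp: cycle_verts_eq apath_def awalk_iff)
  then show "preperiod f v \<le> n"
    using periodic_funpow_iff[OF eventually_periodic_vertex[OF v]] by simp
qed

lemma height_eq: "height (with_proj G) = Max (preperiod f ` pverts G)"
  unfolding height_def using dist_to_cycle_eq by (auto intro!: arg_cong[where f=Max] image_cong)

text \<open>The hypothesis \<open>same\<close> is what connectedness supplies once a component takes
  the place of \<open>G\<close>: all cycles have one length, so \<open>THE\<close> has a unique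
  witness.\<close>

lemma cycle_length_eq:
  assumes v: "v \<in> pverts G"
    and same: "\<And>w. w \<in> pverts G \<Longrightarrow> eventual_period f w = eventual_period f v"
  shows "cycle_length (with_proj G) = eventual_period f v"
  unfolding cycle_length_def
proof (rule the_equality)
  let ?w = "(f ^^ preperiod f v) v"
  have "periodic f ?w" using periodic_funpow_iff[OF eventually_periodic_vertex[OF v]] by simp
  then have "cycle (orbit_walk ?w (period f ?w))"
    using funpow_closed[OF v] by (auto simp: cycle_iff)
  then show "\<exists>p. cycle p \<and> length p = eventual_period f v"
    unfolding eventual_period_def using length_orbit_walk by blast
next
  fix n assume "\<exists>p. cycle p \<and> length p = n"
  then obtain w where "w \<in> pverts G" "periodic f w" "n = period f w"
    by (auto simp: cycle_iff)
  then show "n = eventual_period f v"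
    using same eventual_period_periodic(2)[of f w] by simp
qed

subsection \<open>Connected components\<close>

text \<open>The component of \<open>u\<close> in the underlying undirected graph: two vertices are
  joined exactly if their forward orbits meet. That this is the library notion is shown in
  \<open>components_eq\<close>.\<close>

definition component_verts :: "'a \<Rightarrow> 'a set" where
  "component_verts u = {v \<in> pverts G. \<exists>i j. (f ^^ i) u = (f ^^ j) v}"

definition component :: "'a \<Rightarrow> 'a pair_pre_digraph" where
  "component u = \<lparr>pverts = component_verts u, parcs = (\<lambda>v. (v, f v)) ` component_verts u\<rparr>"

lemma self_in_component_verts: "u \<in> pverts G \<Longrightarrow> u \<in> component_verts u"
  by (auto simp: component_verts_def)

text \<open>The orbit of \<open>v\<close> continues through \<open>f v\<close>, so membership passes
  along arcs in both directions, as undirected connectedness requires.\<close>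

lemma f_in_component_verts_iff:
  assumes "v \<in> pverts G"
  shows "f v \<in> component_verts u \<longleftrightarrow> v \<in> component_verts u"
proof
  assume "f v \<in> component_verts u"
  then obtain i j where "(f ^^ i) u = (f ^^ j) (f v)" by (auto simp: component_verts_def)
  then have "(f ^^ i) u = (f ^^ Suc j) v" by (simp add: funpow_swap1)
  then show "v \<in> component_verts u" using assms unfolding component_verts_def by blast
next
  assume "v \<in> component_verts u"
  then obtain i j where "(f ^^ i) u = (f ^^ j) v" by (auto simp: component_verts_def)
  then have "(f ^^ Suc i) u = (f ^^ j) (f v)" by (simp add: funpow_swap1)
  then show "f v \<in> component_verts u"
    using assms f_closed unfolding component_verts_def by blast
qed

lemma funpow_in_component_verts_iff:
  "v \<in> pverts G \<Longrightarrow> (f ^^ n) v \<in> component_verts u \<longleftrightarrow> v \<in> component_verts u"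
  by (induction n) (auto simp: f_in_component_verts_iff funpow_closed)

lemma component_verts_sub: "component_verts u \<subseteq> pverts G"
  by (auto simp: component_verts_def)

lemma functional_component: "functional_digraph (component u) f"
  using component_verts_sub finite_pverts
  by unfold_locales
    (auto simp: component_def f_in_component_verts_iff subset_iff intro: finite_subset)

lemma subgraph_component: "subgraph (with_proj (component u)) (with_proj G)"
proof -
  interpret C: functional_digraph "component u" f by (rule functional_component)
  show ?thesis
    using component_verts_sub
    by (intro subgraphI C.wf_digraph_axioms wf_digraph_axioms compatibleI_with_proj)
      (auto simp: component_def parcs_eq)
qed

text \<open>In the symmetrization, walk from \<open>u\<close> forward to a vertex common to both
  orbits, then backward to \<open>v\<close>. So \<open>u\<close> reaches every vertex, and symmetry
  gives the rest.\<close>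

lemma connected_component:
  assumes "u \<in> pverts G"
  shows "connected (with_proj (component u))"
proof -
  interpret C: functional_digraph "component u" f by (rule functional_component)
  let ?M = "with_proj (mk_symmetric (with_proj (component u)))"
  interpret M: pair_wf_digraph "mk_symmetric (with_proj (component u))"
    by (rule C.wellformed_mk_symmetric)
  have to: "v \<rightarrow>\<^sup>*\<^bsub>?M\<^esub> (f ^^ n) v" if "v \<in> component_verts u" for v n
  proof (rule C.reachable_mk_symmetricI)
    have "v \<in> pverts (component u)" using that by (simp add: component_def)
    then show "v \<rightarrow>\<^sup>*\<^bsub>with_proj (component u)\<^esub> (f ^^ n) v"
      by (rule C.reachable_awalkI[OF C.awalk_orbit_walk])
  qed
  have sym: "a \<rightarrow>\<^sup>*\<^bsub>?M\<^esub> b" if "b \<rightarrow>\<^sup>*\<^bsub>?M\<^esub> a" for a b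
    by (rule symmetric_reachable[OF symmetric_mk_symmetric that])
  have to_u: "u \<rightarrow>\<^sup>*\<^bsub>?M\<^esub> v" if v: "v \<in> component_verts u" for v
  proof -
    obtain i j where "(f ^^ i) u = (f ^^ j) v" using v by (auto simp: component_verts_def)
    then show ?thesis
      using to[OF self_in_component_verts[OF assms], of i] sym[OF to[OF v, of j]]
        M.reachable_trans by simp
  qed
  show ?thesis
    unfolding connected_def
  proof (rule strongly_connectedI)
    show "verts ?M \<noteq> {}" using self_in_component_verts[OF assms] by (auto simp: component_def)
    fix v w assume "v \<in> verts ?M" "w \<in> verts ?M"
    then show "v \<rightarrow>\<^sup>*\<^bsub>?M\<^esub> w"
      using to_u[of w] sym[OF to_u[of v]] M.reachable_trans by (simp add: component_def)
  qed
qed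

text \<open>An undirected path in \<open>H\<close> from \<open>u\<close> never leaves
  \<open>component_verts u\<close>, which is closed under arcs in both directions. The arcs follow
  because an arc of \<open>G\<close> is determined by its tail.\<close>

lemma subgraph_component_if_connected:
  assumes H: "subgraph H (with_proj G)" and con: "connected H" and u: "u \<in> verts H"
  shows "subgraph H (with_proj (component u))"
proof -
  interpret C: functional_digraph "component u" f by (rule functional_component)
  interpret H: wf_digraph H using H by auto
  have ends: "tail H = fst" "head H = snd" and sub: "verts H \<subseteq> pverts G" "arcs H \<subseteq> parcs G"
    using H by (auto simp: subgraph_def compatible_def)
  let ?M = "with_proj (mk_symmetric H)"
  interpret M: pair_wf_digraph "mk_symmetric H"
    by (rule H.wellformed_mk_symmetric)
  have "v \<in> component_verts u" if "v \<in> verts H" for v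
  proof -
    have "u \<rightarrow>\<^sup>*\<^bsub>?M\<^esub> v"
      using con u that by (auto simp: connected_def)
    then show ?thesis
    proof (induction rule: M.reachable_induct)
      case base
      show ?case using self_in_component_verts u sub by auto
    next
      case (step v w)
      then have "(v, w) \<in> parcs G \<or> (w, v) \<in> parcs G"
        using sub by (auto simp: parcs_mk_symmetric ends)
      then show ?case
        using step.IH f_in_component_verts_iff by (auto simp: parcs_eq)
    qed
  qed
  then have V: "verts H \<subseteq> component_verts u" by auto
  have "arcs H \<subseteq> parcs (component u)"
  proof
    fix e assume e: "e \<in> arcs H"
    then have "e \<in> parcs G" "fst e \<in> verts H" using sub H.tail_in_verts ends by auto
    then show "e \<in> parcs (component u)" using V by (auto simp: component_def parcs_eq)
  qed
  then show ?thesis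
    using V ends by (intro subgraphI H.wf_digraph_axioms C.wf_digraph_axioms)
      (auto simp: component_def compatible_def)
qed

text \<open>\<open>component u\<close> is connected and contains every connected subgraph through
  \<open>u\<close>, hence is maximal; a maximal connected \<open>H\<close> equals the component of
  any of its vertices.\<close>

lemma components_eq: "components (with_proj G) = (\<lambda>u. with_proj (component u)) ` pverts G"
proof (intro equalityI subsetI)
  fix H assume "H \<in> components (with_proj G)"
  then have maximal: "max_subgraph connected H" by (simp add: components_def)
  then have H: "subgraph H (with_proj G)" "connected H"
    by (auto simp: max_subgraph_def)
  then obtain u where u: "u \<in> verts H"
    by (auto simp: connected_def strongly_connected_def)
  then have uG: "u \<in> pverts G" using subgraph_imp_subverts[OF H(1)] by auto
  have "\<not> with_proj (component u) \<noteq> H"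
    using maximal subgraph_component_if_connected[OF H u] connected_component[OF uG]
      subgraph_component[of u]
    unfolding max_subgraph_def by blast
  then show "H \<in> (\<lambda>u. with_proj (component u)) ` pverts G" using uG by auto
next
  fix H assume "H \<in> (\<lambda>u. with_proj (component u)) ` pverts G"
  then obtain u where u: "u \<in> pverts G" and H: "H = with_proj (component u)" by auto
  have "max_subgraph connected H"
    unfolding max_subgraph_def
  proof (intro conjI allI impI notI)
    show "subgraph H (with_proj G)" "connected H"
      using H subgraph_component connected_component[OF u] by auto
    fix H' assume H': "H' \<noteq> H \<and> subgraph H H'" "subgraph H' (with_proj G) \<and> connected H'"
    then have "verts H \<subseteq> verts H'" using subgraph_imp_subverts by blast
    then have "u \<in> verts H'"
      using H self_in_component_verts[OF u] by (auto simp: component_def)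
    then have "subgraph H' H" using subgraph_component_if_connected H' H by auto
    then have "H' = H"
      using H' by (intro pre_digraph.equality) (auto simp: subgraph_def compatible_def)
    then show False using H' by simp
  qed
  then show "H \<in> components (with_proj G)" by (simp add: components_def)
qed

section \<open>Cycle lengths and heights of components\<close>

lemma cycle_length_component:
  assumes "u \<in> pverts G"
  shows "cycle_length (with_proj (component u)) = eventual_period f u"
proof -
  interpret C: functional_digraph "component u" f by (rule functional_component)
  show ?thesis
  proof (rule C.cycle_length_eq)
    show "u \<in> pverts (component u)"
      using self_in_component_verts[OF assms] by (simp add: component_def)
    fix w assume "w \<in> pverts (component u)"
    then obtain i j where "w \<in> pverts G" "(f ^^ i) u = (f ^^ j) w"
      by (auto simp: component_def component_verts_def)
    then show "eventual_period f w = eventual_period f u"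
      using eventual_period_eqI[of f u w i j] eventually_periodic_vertex assms by simp
  qed
qed

lemma height_component:
  "height (with_proj (component u)) = Max (preperiod f ` component_verts u)"
  using functional_digraph.height_eq[OF functional_component] by (simp add: component_def)

lemma preperiod_le_height:
  assumes "v \<in> component_verts u"
  shows "preperiod f v \<le> height (with_proj (component u))"
  unfolding height_component
  using assms finite_subset[OF component_verts_sub finite_pverts] by auto

lemma height_attained:
  assumes "u \<in> pverts G"
  obtains v where "v \<in> component_verts u" "preperiod f v = height (with_proj (component u))"
proof -
  have "height (with_proj (component u)) \<in> preperiod f ` component_verts u"
    unfolding height_component
    using finite_subset[OF component_verts_sub finite_pverts] self_in_component_verts[OF assms]
    by (intro Max_in) auto
  then show ?thesis using that by auto
qed

text \<open>In a dominating component, take \<open>c\<close> at maximal distance from the cycle.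
  Conversely, the component of \<open>c\<close> dominates, because its height is at least
  \<open>preperiod f c\<close>.\<close>

lemma dominating_component_iff:
  "(\<exists>C \<in> components (with_proj G). \<forall>D \<in> components (with_proj G).
      cycle_length D dvd cycle_length C \<and> height D \<le> height C + 1) \<longleftrightarrow>
   (\<exists>c\<in>pverts G. \<forall>v\<in>pverts G.
      preperiod f v \<le> preperiod f c + 1 \<and> eventual_period f v dvd eventual_period f c)"
    (is "?L \<longleftrightarrow> ?R")
proof
  assume ?L
  then obtain u where u: "u \<in> pverts G"
    and dom: "\<And>v. v \<in> pverts G \<Longrightarrow> eventual_period f v dvd eventual_period f u \<and>
      height (with_proj (component v)) \<le> height (with_proj (component u)) + 1"
    by (auto simp: components_eq cycle_length_component)
  obtain c where c: "c \<in> component_verts u" "preperiod f c = height (with_proj (component u))"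
    using height_attained[OF u] .
  then have cG: "c \<in> pverts G" using component_verts_sub by auto
  obtain i j where "(f ^^ i) u = (f ^^ j) c" using c by (auto simp: component_verts_def)
  then have per: "eventual_period f c = eventual_period f u"
    using eventual_period_eqI[of f u c i j] eventually_periodic_vertex u cG by simp
  show ?R
  proof (intro bexI[OF _ cG] ballI)
    fix v assume v: "v \<in> pverts G"
    show "preperiod f v \<le> preperiod f c + 1 \<and> eventual_period f v dvd eventual_period f c"
      using dom[OF v] preperiod_le_height[OF self_in_component_verts[OF v]] c(2) per by simp
  qed
next
  assume ?R
  then obtain c where c: "c \<in> pverts G"
    and dom: "\<And>v. v \<in> pverts G \<Longrightarrow>
      preperiod f v \<le> preperiod f c + 1 \<and> eventual_period f v dvd eventual_period f c"
    by auto
  have "height (with_proj (component v)) \<le> height (with_proj (component c)) + 1"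
    if v: "v \<in> pverts G" for v
  proof -
    obtain w where w: "w \<in> component_verts v" "preperiod f w = height (with_proj (component v))"
      using height_attained[OF v] .
    then have "preperiod f w \<le> preperiod f c + 1" using dom component_verts_sub by blast
    then show ?thesis
      using w preperiod_le_height[OF self_in_component_verts[OF c]] by linarith
  qed
  then show ?L
    using c dom by (auto simp: components_eq cycle_length_component intro!: bexI[of _ c])
qed

section \<open>Semigroup structures on a functional digraph\<close>

lemma collisions_if_semigroup_digraph:
  assumes "semigroup_digraph G" "pverts G \<noteq> {}"
  shows "\<exists>c\<in>pverts G. \<forall>v\<in>pverts G. \<forall>i j. (f ^^ i) c = (f ^^ j) c \<longrightarrow>
    (f ^^ Suc i) v = (f ^^ Suc j) v"
proof -
  obtain S :: "nat set" and mul C where "finite_semigroup S mul" and C: "C \<subseteq> S"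
    and iso: "digraph_iso (with_proj G) (with_proj (Cay S mul C))"
    using assms(1) unfolding semigroup_digraph_def by auto
  interpret S: finite_semigroup S mul by fact
  obtain h where h: "digraph_isomorphism h" and Cay: "with_proj (Cay S mul C) = app_iso h (with_proj G)"
    using iso unfolding digraph_iso_def by auto
  define \<phi> where "\<phi> = iso_verts h"
  have inj: "inj_on \<phi> (pverts G)"
    using h by (simp add: digraph_isomorphism_def \<phi>_def)
  have S: "S = \<phi> ` pverts G"
    using arg_cong[OF Cay, of verts] by (simp add: Cay_def \<phi>_def)
  have ends: "iso_tail h = fst" "iso_head h = snd"
    using arg_cong[OF Cay, of tail] arg_cong[OF Cay, of head] by simp_all
  have "iso_arcs h e = (\<phi> (fst e), \<phi> (snd e))" if "e \<in> parcs G" for e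
    using that h unfolding digraph_isomorphism_def ends \<phi>_def by (simp add: prod_eq_iff)
  then have arcs: "parcs (Cay S mul C) = (\<lambda>v. (\<phi> v, \<phi> (f v))) ` pverts G"
    using arg_cong[OF Cay, of arcs] by (simp add: parcs_eq image_image)
  \<comment> \<open>Every vertex has an out-arc, so \<open>C\<close> cannot be empty. Any element
    may serve as \<open>c0\<close>: with out-degree one, all elements of \<open>C\<close> act alike
    from the right.\<close>
  then have "parcs (Cay S mul C) \<noteq> {}" using assms(2) by simp
  then obtain c0 where c0: "c0 \<in> C" by (auto simp: Cay_def)
  then obtain c where c: "c \<in> pverts G" "\<phi> c = c0" using C S by auto
  have step: "\<phi> (f v) = mul (\<phi> v) c0" if v: "v \<in> pverts G" for v
  proof -
    have "(\<phi> v, mul (\<phi> v) c0) \<in> parcs (Cay S mul C)"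
      using c0 v S by (auto simp: Cay_def)
    then obtain v' where "v' \<in> pverts G" "\<phi> v' = \<phi> v" "mul (\<phi> v) c0 = \<phi> (f v')"
      unfolding arcs by auto
    then show ?thesis using inj v by (metis inj_onD)
  qed
  \<comment> \<open>By associativity the iterates at \<open>v\<close> are products with the iterates
    at \<open>c\<close>. Hence \<open>(f ^^ Suc i) v\<close> depends on \<open>i\<close> only
    through \<open>(f ^^ i) c\<close>.\<close>
  have mult: "\<phi> ((f ^^ Suc i) v) = mul (\<phi> v) (\<phi> ((f ^^ i) c))" if v: "v \<in> pverts G" for v i
  proof (induction i)
    case 0
    then show ?case using step[OF v] c by simp
  next
    case (Suc i)
    have in_S: "\<phi> v \<in> S" "\<phi> ((f ^^ i) c) \<in> S" "c0 \<in> S"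
      using v c funpow_closed S by auto
    have "\<phi> ((f ^^ Suc (Suc i)) v) = mul (\<phi> ((f ^^ Suc i) v)) c0"
      using step[OF funpow_closed[OF v, of "Suc i"]] by simp
    also have "\<dots> = mul (\<phi> v) (mul (\<phi> ((f ^^ i) c)) c0)"
      unfolding Suc using S.assoc[OF in_S] .
    also have "\<dots> = mul (\<phi> v) (\<phi> ((f ^^ Suc i) c))"
      using step[OF funpow_closed[OF c(1), of i]] by simp
    finally show ?case .
  qed
  show ?thesis
  proof (intro bexI[OF _ c(1)] allI impI ballI)
    fix v i j assume v: "v \<in> pverts G" and "(f ^^ i) c = (f ^^ j) c"
    then have "\<phi> ((f ^^ Suc i) v) = \<phi> ((f ^^ Suc j) v)" by (simp only: mult[OF v])
    then show "(f ^^ Suc i) v = (f ^^ Suc j) v"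
      using inj_onD[OF inj] funpow_closed[OF v] by blast
  qed
qed

text \<open>A vertex \<open>y\<close> in the component of \<open>c\<close> acts from the right as
  the power of \<open>f\<close> with exponent \<open>a y\<close>; all other vertices act as
  constants. The condition \<open>exp_f\<close> compares powers of \<open>f\<close> rather than
  exponents, since \<open>a\<close> cannot keep growing around a cycle. By \<open>exp_c\<close>,
  right translation by \<open>c\<close> is \<open>f\<close>.\<close>

lemma semigroup_digraph_if_exponents:
  assumes c: "c \<in> pverts G"
    and exp_c: "\<And>v. v \<in> pverts G \<Longrightarrow> (f ^^ a c) v = f v"
    and exp_f: "\<And>v y. v \<in> pverts G \<Longrightarrow> y \<in> component_verts c \<Longrightarrow>
      (f ^^ a (f y)) v = (f ^^ Suc (a y)) v"
  shows "semigroup_digraph G"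
proof (rule semigroup_digraphI)
  define mul where "mul = (\<lambda>x y. if y \<in> component_verts c then (f ^^ a y) x else y)"
  have exp: "(f ^^ a ((f ^^ n) y)) v = (f ^^ (n + a y)) v"
    if "v \<in> pverts G" "y \<in> component_verts c" for n y v
  proof (induction n)
    case (Suc n)
    have "(f ^^ n) y \<in> component_verts c"
      using that funpow_in_component_verts_iff component_verts_sub by blast
    then show ?case using exp_f[OF that(1), of "(f ^^ n) y"] Suc by simp
  qed simp
  show "finite_semigroup (pverts G) mul"
  proof
    show "finite (pverts G)" "pverts G \<noteq> {}" using finite_pverts c by auto
    show "mul x y \<in> pverts G" if "x \<in> pverts G" "y \<in> pverts G" for x y
      using that by (simp add: mul_def funpow_closed)
    \<comment> \<open>If \<open>z\<close> is outside the component, both sides are \<open>z\<close>.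
      Otherwise \<open>mul y z\<close> is \<open>(f ^^ a z) y\<close>, which is in the component iff
      \<open>y\<close> is: if so, exponents add up by \<open>exp\<close>; if not, both sides are
      \<open>(f ^^ a z) y\<close>.\<close>
    show "mul (mul x y) z = mul x (mul y z)"
      if "x \<in> pverts G" "y \<in> pverts G" "z \<in> pverts G" for x y z
      using that by (simp add: mul_def funpow_in_component_verts_iff exp funpow_add)
  qed
  show "{c} \<subseteq> pverts G" using c by simp
  have "Cay (pverts G) mul {c} = G"
  proof (rule pair_pre_digraph.equality)
    show "parcs (Cay (pverts G) mul {c}) = parcs G"
      using self_in_component_verts[OF c] exp_c
      by (auto simp: Cay_def parcs_eq mul_def)
  qed (auto simp: Cay_def)
  then show "digraph_iso (with_proj G) (with_proj (Cay (pverts G) mul {c}))"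
    unfolding digraph_iso_def digraph_isomorphism_def
    by (intro exI[of _ "\<lparr>iso_verts = id, iso_arcs = id, iso_head = snd, iso_tail = fst\<rparr>"])
      (auto simp: app_iso_def with_proj_def wf_digraph_axioms[unfolded with_proj_def])
qed

lemma semigroup_digraph_if_collisions:
  assumes c: "c \<in> pverts G"
    and coll: "\<And>v i j. v \<in> pverts G \<Longrightarrow> (f ^^ i) c = (f ^^ j) c \<Longrightarrow>
      (f ^^ Suc i) v = (f ^^ Suc j) v"
  shows "semigroup_digraph G"
proof -
  txt \<open>
    \<open>y\<close> first meets the cycle at the vertex \<open>w\<close> that \<open>c\<close> reaches after \<open>\<mu> w\<close> steps, so \<open>y\<close> behaves
    like \<open>f\<^sup>m c\<close> with the possibly negative index \<open>m = \<mu> w - preperiod f y \<ge> -1\<close>; in particular the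
    subtraction in \<open>a\<close> is never truncated. Taking the least \<open>\<mu> w\<close> gives \<open>a c = 1\<close>.
  \<close>
  define k where "k = preperiod f c"
  define \<mu> where "\<mu> w = (LEAST m. k \<le> m \<and> (f ^^ m) c = w)" for w
  define a where "a y = Suc (\<mu> ((f ^^ preperiod f y) y)) - preperiod f y" for y
  \<comment> \<open>The \<open>LEAST\<close> is attained: the orbits of \<open>c\<close> and
    \<open>w\<close> meet, and going on around the cycle leads back to \<open>w\<close>. Taking
    \<open>n\<close> at least \<open>j + k\<close> keeps \<open>n - j\<close> from being truncated
    and the resulting index at least \<open>k\<close>.\<close>
  have mu: "k \<le> \<mu> w \<and> (f ^^ \<mu> w) c = w" if w: "w \<in> component_verts c" "periodic f w" for w
  proof -
    obtain i j where ij: "(f ^^ i) c = (f ^^ j) w" using w by (auto simp: component_verts_def)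
    obtain n where n: "j + k \<le> n" "(f ^^ n) w = w"
    proof
      show "j + k \<le> (j + k) * period f w" using period_pos[OF w(2)] by simp
      show "(f ^^ ((j + k) * period f w)) w = w" by (rule funpow_mult_period[OF w(2)])
    qed
    have "(f ^^ (n - j + i)) c = (f ^^ (n - j + j)) w" by (rule funpow_shift[OF ij])
    also have "\<dots> = w" using n by simp
    finally have "k \<le> n - j + i \<and> (f ^^ (n - j + i)) c = w" using n(1) by linarith
    then show ?thesis unfolding \<mu>_def by (rule LeastI)
  qed
  have mu_c: "\<mu> ((f ^^ k) c) = k"
    unfolding \<mu>_def by (rule Least_equality) auto
  show ?thesis
  proof (rule semigroup_digraph_if_exponents[OF c, of a])
    show "(f ^^ a c) v = f v" if "v \<in> pverts G" for v
      using mu_c by (simp add: a_def flip: k_def)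
  next
    fix v y assume v: "v \<in> pverts G" and y: "y \<in> component_verts c"
    then have yG: "y \<in> pverts G" using component_verts_sub by auto
    note ev = eventually_periodic_vertex[OF yG]
    have fy: "f y \<in> component_verts c" using y yG f_in_component_verts_iff by simp
    show "(f ^^ a (f y)) v = (f ^^ Suc (a y)) v"
    proof (cases "periodic f y")
      case True
      then have per: "periodic f (f y)" using periodic_funpow[of f y 1] by simp
      \<comment> \<open>On the cycle, \<open>\<mu> (f y)\<close> and \<open>Suc (\<mu> y)\<close>
        may differ by a full turn, but both lead \<open>c\<close> to \<open>f y\<close>. Then
        \<open>coll\<close> equates the powers with exponents one higher, which are those that
        \<open>a\<close> prescribes.\<close>
      have "(f ^^ \<mu> (f y)) c = (f ^^ Suc (\<mu> y)) c"
        using mu[OF fy per] mu[OF y True] by simp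
      from coll[OF v this] show ?thesis
        using eventual_period_periodic(1)[OF True] eventual_period_periodic(1)[OF per]
        by (simp add: a_def)
    next
      case False
      then obtain l where l: "preperiod f y = Suc l"
        using periodic_funpow_iff[OF ev, of 0] by (cases "preperiod f y") auto
      have "periodic f ((f ^^ n) (f y)) \<longleftrightarrow> l \<le> n" for n
        using periodic_funpow_iff[OF ev, of "Suc n"] l by (simp add: funpow_swap1)
      then have l': "preperiod f (f y) = l"
        unfolding preperiod_def by (auto intro: Least_equality)
      have "(f ^^ Suc l) y \<in> component_verts c"
        using y yG funpow_in_component_verts_iff by blast
      then have "k \<le> \<mu> ((f ^^ Suc l) y)"
        using mu periodic_funpow_iff[OF ev, of "Suc l"] l by simp
      \<comment> \<open>The collision hypothesis bounds the preperiod of \<open>y\<close>, which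
        keeps the subtraction exact. As \<open>y\<close> and \<open>f y\<close> enter the cycle at
        the same vertex, their exponents then differ by exactly one.\<close>
      moreover have "Suc l \<le> Suc k"
      proof -
        have "\<forall>i j. (f ^^ i) c = (f ^^ j) c \<longrightarrow> (f ^^ Suc i) y = (f ^^ Suc j) y"
          by (intro allI impI) (rule coll[OF yG])
        then have "preperiod f y \<le> preperiod f c + 1"
          unfolding orbit_collisions_iff[OF eventually_periodic_vertex[OF c] ev] by (rule conjunct1)
        then show ?thesis unfolding l k_def by simp
      qed
      ultimately have "Suc (\<mu> ((f ^^ Suc l) y)) - l = Suc (Suc (\<mu> ((f ^^ Suc l) y)) - Suc l)"
        by linarith
      moreover have "(f ^^ l) (f y) = (f ^^ Suc l) y"
        by (simp add: funpow_swap1)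
      ultimately have "a (f y) = Suc (a y)"
        by (simp only: a_def l l')
      then show ?thesis by (simp only:)
    qed
  qed
qed

lemma semigroup_digraph_iff:
  assumes "pverts G \<noteq> {}"
  shows "semigroup_digraph G \<longleftrightarrow> (\<exists>c\<in>pverts G. \<forall>v\<in>pverts G.
    preperiod f v \<le> preperiod f c + 1 \<and> eventual_period f v dvd eventual_period f c)"
proof -
  have "semigroup_digraph G \<longleftrightarrow> (\<exists>c\<in>pverts G. \<forall>v\<in>pverts G. \<forall>i j.
    (f ^^ i) c = (f ^^ j) c \<longrightarrow> (f ^^ Suc i) v = (f ^^ Suc j) v)"
  proof
    assume "\<exists>c\<in>pverts G. \<forall>v\<in>pverts G. \<forall>i j.
      (f ^^ i) c = (f ^^ j) c \<longrightarrow> (f ^^ Suc i) v = (f ^^ Suc j) v"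
    then obtain c where "c \<in> pverts G"
      "\<And>v i j. v \<in> pverts G \<Longrightarrow> (f ^^ i) c = (f ^^ j) c \<Longrightarrow> (f ^^ Suc i) v = (f ^^ Suc j) v"
      by blast
    then show "semigroup_digraph G" by (rule semigroup_digraph_if_collisions)
  qed (rule collisions_if_semigroup_digraph[OF _ assms])
  also have "\<dots> \<longleftrightarrow> (\<exists>c\<in>pverts G. \<forall>v\<in>pverts G.
    preperiod f v \<le> preperiod f c + 1 \<and> eventual_period f v dvd eventual_period f c)"
    by (rule bex_cong[OF refl], rule ball_cong[OF refl], rule orbit_collisions_iff)
      (simp_all add: eventually_periodic_vertex)
  finally show ?thesis .
qed

end

section \<open>From one-outregular digraphs to self-maps\<close>

lemma one_outregular_functional:
  assumes "pair_fin_digraph G" "one_outregular (with_proj G)"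
  obtains f where "functional_digraph G f"
proof -
  interpret pair_fin_digraph G by fact
  \<comment> \<open>Arcs are pairs, so a single out-arc means a single out-neighbour; choosing it at
    every vertex defines \<open>f\<close>.\<close>
  have "\<exists>w. \<forall>w'. (v, w') \<in> parcs G \<longleftrightarrow> w' = w" if "v \<in> pverts G" for v
  proof -
    have "card {e \<in> parcs G. fst e = v} = 1"
      using assms(2) that by (simp add: one_outregular_def out_degree_def out_arcs_def)
    then obtain e where e: "{e \<in> parcs G. fst e = v} = {e}" by (rule card_1_singletonE)
    have "fst e = v" using e by blast
    have "(v, w') \<in> parcs G \<longleftrightarrow> (v, w') \<in> {e \<in> parcs G. fst e = v}" for w' by simp
    then have "(v, w') \<in> parcs G \<longleftrightarrow> w' = snd e" for w'
      unfolding e using \<open>fst e = v\<close> by (cases e) simp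
    then show ?thesis by blast
  qed
  then obtain f where f: "\<And>v w. v \<in> pverts G \<Longrightarrow> (v, w) \<in> parcs G \<longleftrightarrow> w = f v"
    by metis
  have "functional_digraph G f"
  proof
    show "finite (pverts G)" using finite_verts by simp
    show "parcs G = (\<lambda>v. (v, f v)) ` pverts G"
    proof (intro equalityI subrelI image_subsetI)
      fix v w assume vw: "(v, w) \<in> parcs G"
      then have v: "v \<in> pverts G" by (rule in_arcsD1)
      then show "(v, w) \<in> (\<lambda>v. (v, f v)) ` pverts G" using f[OF v, of w] vw by simp
    qed (auto simp: f)
    show "f v \<in> pverts G" if "v \<in> pverts G" for v
    proof (rule in_arcsD2)
      show "(v, f v) \<in> parcs G" using f[OF that] by simp
    qed
  qed
  then show ?thesis by (rule that)
qed

theorem corollary3p3: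
  fixes G :: "'a pair_pre_digraph"
  assumes "pair_fin_digraph G"
    and "pverts G \<noteq> {}"
    and "one_outregular (with_proj G)"
  shows "semigroup_digraph G \<longleftrightarrow>
    (\<exists>C \<in> components (with_proj G). \<forall>D \<in> components (with_proj G).
      cycle_length D dvd cycle_length C \<and> height D \<le> height C + 1)"
proof -
  obtain f where "functional_digraph G f"
    using one_outregular_functional[OF assms(1,3)] .
  then interpret functional_digraph G f .
  show ?thesis
    unfolding dominating_component_iff using semigroup_digraph_iff[OF assms(2)] .
qed

end
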